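(* Consider the soft-thresholding estimator $\hat\theta_S$ with $\eta_n\to0$ and $n^{1/2}\eta_n\to e$, $0\le e<\infty$. Suppose the true parameters $\theta_n\in\mathbb{R}$ satisfy $n^{1/2}\theta_n\to\nu\in\mathbb{R}\cup\{-\infty,\infty\}$. Then $F_{S,n,\theta_n}$ converges weakly to the distribution given by $$\{\Phi(-\nu+e)-\Phi(-\nu-e)\}\,d\delta_{-\nu}(x)+\{\phi(x+e)\,\boldsymbol{1}(x>-\nu)+\phi(x-e)\,\boldsymbol{1}(x<-\nu)\}\,dx.$$ [This limit reduces to the $N(-\mathrm{sign}(\nu)e,1)$-distribution in case $|\nu|=\infty$ or $e=0$.]
   Context: For each $n\ge1$ and $\theta\in\mathbb{R}$, $P_{n,\theta}$ is the probability measure under which $y_1,\dots,y_n$ are independent and each $N(\theta,1)$-distributed; $\bar y=n^{-1}\sum_{t=1}^n y_t$. $(\eta_n)$ is a sequence of positive real numbers, and $\hat\theta_S=\mathrm{sign}(\bar y)(|\bar y|-\eta_n)_+$, where $z_+=\max\{z,0\}$ and $\mathrm{sign}(x)=-1,0,1$ for $x<0$, $x=0$, $x>0$ (with $\mathrm{sign}(\pm\infty)=\pm1$). $F_{S,n,\theta}$ denotes the distribution (and its cdf) of $n^{1/2}(\hat\theta_S-\theta)$ under $P_{n,\theta}$. $\Phi$ and $\phi$ are the standard normal cdf and density, $\Phi(-\infty)=0$, $\Phi(\infty)=1$; $\delta_z$ is pointmass at $z$; $\boldsymbol{1}(\cdot)$ is the indicator function. When $|\nu|=\infty$ the coefficient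 of the atomic part is $0$, so that part is absent. *)

theory Defs
  imports "HOL-Probability.Probability"
begin

text \<open>The sample \<open>y\<^sub>1, \<dots>, y\<^sub>n\<close> is the coordinate process on the n-fold product space, with index set
  \<open>{1..n}\<close>. In \<open>normal_density \<mu> \<sigma>\<close> the second argument is the standard deviation.\<close>

definition sample_measure :: "nat \<Rightarrow> real \<Rightarrow> (nat \<Rightarrow> real) measure" where
  "sample_measure n \<theta> = (\<Pi>\<^sub>M t\<in>{1..n}. density lborel (normal_density \<theta> 1))"

definition sample_mean :: "nat \<Rightarrow> (nat \<Rightarrow> real) \<Rightarrow> real" where
  "sample_mean n y = (\<Sum>t=1..n. y t) / real n"

definition soft_est :: "real \<Rightarrow> nat \<Rightarrow> (nat \<Rightarrow> real) \<Rightarrow> real" where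
  "soft_est \<eta> n y = sgn (sample_mean n y) * max (\<bar>sample_mean n y\<bar> - \<eta>) 0"

definition soft_dist :: "real \<Rightarrow> nat \<Rightarrow> real \<Rightarrow> real measure" where
  "soft_dist \<eta> n \<theta> =
     distr (sample_measure n \<theta>) borel (\<lambda>y. sqrt (real n) * (soft_est \<eta> n y - \<theta>))"

definition Phi :: "ereal \<Rightarrow> real" where
  "Phi z = (case z of
      ereal x \<Rightarrow> cdf (density lborel std_normal_density) x
    | PInfty \<Rightarrow> 1
    | MInfty \<Rightarrow> 0)"

text \<open>For \<open>\<bar>\<nu>\<bar> = \<infinity>\<close> both values of \<open>Phi\<close> below coincide, so the atom has weight 0 and its
  location, the dummy value \<open>real_of_ereal (- \<nu>) = 0\<close>, is irrelevant.\<close>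

definition soft_limit :: "real \<Rightarrow> ereal \<Rightarrow> real measure" where
  "soft_limit e \<nu> = measure_of UNIV (sets borel) (\<lambda>A.
      ennreal (Phi (- \<nu> + ereal e) - Phi (- \<nu> - ereal e))
        * emeasure (return borel (real_of_ereal (- \<nu>))) A
    + (\<integral>\<^sup>+ x\<in>A. ennreal (std_normal_density (x + e) * of_bool (ereal x > - \<nu>)
                      + std_normal_density (x - e) * of_bool (ereal x < - \<nu>)) \<partial>lborel))"

end

theory Submission
  imports Defs
begin

text \<open>The scaled sample mean error \<open>Z = n\<^sup>1\<^sup>/\<^sup>2 (mean - \<theta>)\<close> is exactly standard normal, and soft-thresholding
  commutes with scaling; so \<open>n\<^sup>1\<^sup>/\<^sup>2 (\<theta>\<^sub>S - \<theta>)\<close> is an explicit piecewise affine function of \<open>Z\<close>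
  that depends only on \<open>n\<^sup>1\<^sup>/\<^sup>2 \<eta>\<close> and \<open>n\<^sup>1\<^sup>/\<^sup>2 \<theta>\<close>. Hence the finite-sample distribution is
  \<^emph>\<open>equal\<close> to \<open>soft_limit (n\<^sup>1\<^sup>/\<^sup>2 \<eta>) (n\<^sup>1\<^sup>/\<^sup>2 \<theta>)\<close>, and the theorem says that \<open>soft_limit\<close> depends
  continuously on its parameters. This is read off its cdf, which is \<open>\<Phi>(x + e)\<close> for
  \<open>x \<ge> -\<nu>\<close> and \<open>\<Phi>(x - e)\<close> for \<open>x < -\<nu>\<close>.\<close>

abbreviation std_normal :: "real measure" where
  "std_normal \<equiv> density lborel std_normal_density"

text \<open>Here \<open>z\<close> stands for the standardized mean; the last branch is the event
  that the estimator is set to zero, which produces the atom. The parameter \<open>\<nu>\<close> is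
  extended real so that the limit is covered too: for infinite \<open>\<nu>\<close> a single outer
  branch is taken for all \<open>z\<close>.\<close>

definition soft_error :: "real \<Rightarrow> ereal \<Rightarrow> real \<Rightarrow> real" where
  "soft_error e \<nu> z =
     (if ereal z > - \<nu> + ereal e then z - e
      else if ereal z < - \<nu> - ereal e then z + e
      else real_of_ereal (- \<nu>))"

lemma soft_error_measurable [measurable]: "soft_error e \<nu> \<in> borel_measurable borel"
  unfolding soft_error_def by measurable

section \<open>The standard normal law and its cdf\<close>

lemma real_distribution_std_normal: "real_distribution std_normal"
  unfolding real_distribution_def real_distribution_axioms_def
  by (simp add: prob_space_normal_density)

lemma measure_std_normal_singleton: "measure std_normal {x} = 0"
proof -
  have "emeasure std_normal {x} = 0"
    by (subst emeasure_density) (auto simp: nn_integral_indicator_singleton)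
  then show ?thesis by (simp add: measure_def)
qed

lemma isCont_cdf_std_normal: "isCont (cdf std_normal) x"
proof -
  interpret real_distribution std_normal by (rule real_distribution_std_normal)
  show ?thesis using isCont_cdf measure_std_normal_singleton by blast
qed

lemma measure_std_normal_Icc:
  assumes "a \<le> b"
  shows "measure std_normal {a..b} = cdf std_normal b - cdf std_normal a"
proof -
  interpret real_distribution std_normal by (rule real_distribution_std_normal)
  have "measure std_normal {a..b} = measure std_normal ({a} \<union> {a<..b})"
    using assms by (intro arg_cong[of _ _ "measure std_normal"]) auto
  also have "\<dots> = measure std_normal {a} + measure std_normal {a<..b}"
    by (intro finite_measure_Union) auto
  finally show ?thesis
    using cdf_diff_eq[of a b] assms measure_std_normal_singleton by (cases "a = b") auto
qed

section \<open>The limit law as an image of the standard normal law\<close>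

lemma emeasure_std_normal_atom:
  assumes "0 \<le> e"
  shows "emeasure std_normal {z. - \<nu> - ereal e \<le> ereal z \<and> ereal z \<le> - \<nu> + ereal e}
       = ennreal (Phi (- \<nu> + ereal e) - Phi (- \<nu> - ereal e))"
proof (cases \<nu>)
  case (real r)
  interpret real_distribution std_normal by (rule real_distribution_std_normal)
  have "{z. - \<nu> - ereal e \<le> ereal z \<and> ereal z \<le> - \<nu> + ereal e} = {- r - e..- r + e}"
    using real by auto
  then show ?thesis
    using measure_std_normal_Icc[of "- r - e" "- r + e"] assms real
    by (simp add: emeasure_eq_measure Phi_def)
\<comment> \<open>For infinite \<open>\<nu>\<close> no real \<open>z\<close> satisfies both
  inequalities, and the two values of \<open>Phi\<close> coincide.\<close>
qed (simp_all add: Phi_def)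

text \<open>The integral over \<open>z\<close> splits along the branches of
  \<open>soft_error\<close>. The middle branch is constant and gives the atom; on the outer ones the
  substitutions \<open>x = z - e\<close> and \<open>x = z + e\<close> give the two pieces of the
  density.\<close>

lemma emeasure_distr_soft_error:
  assumes e: "0 \<le> e" and A [measurable]: "A \<in> sets borel"
  shows "emeasure (distr std_normal borel (soft_error e \<nu>)) A =
      ennreal (Phi (- \<nu> + ereal e) - Phi (- \<nu> - ereal e))
        * emeasure (return borel (real_of_ereal (- \<nu>))) A
    + (\<integral>\<^sup>+ x\<in>A. ennreal (std_normal_density (x + e) * of_bool (ereal x > - \<nu>)
                      + std_normal_density (x - e) * of_bool (ereal x < - \<nu>)) \<partial>lborel)"
proof -
  let ?M = "{z. - \<nu> - ereal e \<le> ereal z \<and> ereal z \<le> - \<nu> + ereal e}"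
  let ?R = "\<lambda>x. ennreal (std_normal_density (x + e) * of_bool (ereal x > - \<nu>)) * indicator A x"
  let ?L = "\<lambda>x. ennreal (std_normal_density (x - e) * of_bool (ereal x < - \<nu>)) * indicator A x"
  have [measurable]: "?M \<in> sets borel" by measurable
  have R: "ereal (z - e) > - \<nu> \<longleftrightarrow> ereal z > - \<nu> + ereal e" for z
    by (cases \<nu>) auto
  have L: "ereal (z + e) < - \<nu> \<longleftrightarrow> ereal z < - \<nu> - ereal e" for z
    by (cases \<nu>) auto
  have disj: "\<not> (ereal z > - \<nu> + ereal e \<and> ereal z < - \<nu> - ereal e)" for z
    using e by (cases \<nu>) auto
  \<comment> \<open>By \<open>R\<close> and \<open>L\<close>, the indicators in
    \<open>?R (z - e)\<close> and \<open>?L (z + e)\<close> select the outer branches;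
    \<open>disj\<close> keeps them from overlapping.\<close>
  have split: "ennreal (std_normal_density z) * indicator A (soft_error e \<nu> z)
      = indicator A (real_of_ereal (- \<nu>)) * (ennreal (std_normal_density z) * indicator ?M z)
        + (?R (z - e) + ?L (z + e))" for z
    using disj[of z] unfolding R L soft_error_def
    by (auto simp: indicator_def not_less)
  have "emeasure (distr std_normal borel (soft_error e \<nu>)) A
      = (\<integral>\<^sup>+ z. ennreal (std_normal_density z) * indicator A (soft_error e \<nu> z) \<partial>lborel)"
    by (simp add: nn_integral_indicator[symmetric] nn_integral_distr nn_integral_density
        del: nn_integral_indicator)
  also have "\<dots> = indicator A (real_of_ereal (- \<nu>))
        * (\<integral>\<^sup>+ z. ennreal (std_normal_density z) * indicator ?M z \<partial>lborel)
        + ((\<integral>\<^sup>+ z. ?R (z - e) \<partial>lborel) + (\<integral>\<^sup>+ z. ?L (z + e) \<partial>lborel))"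
    unfolding split by (simp add: nn_integral_add nn_integral_cmult)
  also have "(\<integral>\<^sup>+ z. ennreal (std_normal_density z) * indicator ?M z \<partial>lborel)
      = ennreal (Phi (- \<nu> + ereal e) - Phi (- \<nu> - ereal e))"
    unfolding emeasure_std_normal_atom[OF e, symmetric] by (subst emeasure_density) auto
  also have "(\<integral>\<^sup>+ z. ?R (z - e) \<partial>lborel) = (\<integral>\<^sup>+ x. ?R x \<partial>lborel)"
    by (subst nn_integral_real_affine[of ?R 1 "- e"]) auto
  also have "(\<integral>\<^sup>+ z. ?L (z + e) \<partial>lborel) = (\<integral>\<^sup>+ x. ?L x \<partial>lborel)"
    by (subst nn_integral_real_affine[of ?L 1 e]) (auto simp: add.commute)
  also have "(\<integral>\<^sup>+ x. ?R x \<partial>lborel) + (\<integral>\<^sup>+ x. ?L x \<partial>lborel) =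
     (\<integral>\<^sup>+ x\<in>A. ennreal (std_normal_density (x + e) * of_bool (ereal x > - \<nu>)
                      + std_normal_density (x - e) * of_bool (ereal x < - \<nu>)) \<partial>lborel)"
    by (subst nn_integral_add[symmetric])
       (auto intro!: nn_integral_cong simp: indicator_def)
  finally show ?thesis by (simp add: mult.commute)
qed

text \<open>\<open>soft_limit\<close> is given by \<open>measure_of\<close>, which is only meaningful for a countably additive
  set function; exhibiting it as an image measure avoids checking this.\<close>

lemma soft_limit_eq_distr:
  assumes "0 \<le> e"
  shows "soft_limit e \<nu> = distr std_normal borel (soft_error e \<nu>)" (is "_ = ?D")
proof -
  have "soft_limit e \<nu> = measure_of UNIV (sets borel) (emeasure ?D)"
    unfolding soft_limit_def
    using assms
    by (intro measure_of_eq) (auto simp: emeasure_distr_soft_error sets.sigma_sets_eq[of borel, simplified])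
  also have "\<dots> = ?D"
    using measure_of_of_measure[of ?D] by simp
  finally show ?thesis .
qed

lemma real_distribution_soft_limit:
  assumes "0 \<le> e"
  shows "real_distribution (soft_limit e \<nu>)"
proof -
  interpret real_distribution std_normal by (rule real_distribution_std_normal)
  show ?thesis unfolding soft_limit_eq_distr[OF assms] by simp
qed

text \<open>\<open>soft_error\<close> is nondecreasing in \<open>z\<close> with a flat piece at
  height \<open>- \<nu>\<close>, so sublevel sets are half-lines. At the level
  \<open>- \<nu>\<close> itself the whole flat piece is included, hence \<open>x + e\<close>
  there.\<close>

lemma soft_error_le_iff:
  assumes "0 \<le> e"
  shows "soft_error e \<nu> z \<le> x \<longleftrightarrow> z \<le> (if - \<nu> \<le> ereal x then x + e else x - e)"
  using assms by (cases \<nu>) (auto simp: soft_error_def)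

lemma cdf_soft_limit:
  assumes "0 \<le> e"
  shows "cdf (soft_limit e \<nu>) x = cdf std_normal (if - \<nu> \<le> ereal x then x + e else x - e)"
  using assms
  by (simp add: cdf_def soft_limit_eq_distr measure_distr vimage_def soft_error_le_iff)
     (simp add: atMost_def)

section \<open>The exact finite-sample law\<close>

lemma distributed_scaled_sample_mean:
  assumes n: "n \<ge> 1"
  shows "distributed (sample_measure n \<theta>) lborel
           (\<lambda>y. sqrt (real n) * (sample_mean n y - \<theta>)) std_normal_density"
proof -
  let ?N = "\<lambda>_::nat. density lborel (normal_density \<theta> 1)"
  have N: "prob_space (density lborel (normal_density \<theta> 1))"
    by (simp add: prob_space_normal_density)
  interpret P: prob_space "sample_measure n \<theta>"
    unfolding sample_measure_def by (intro prob_space_PiM N)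
  have comp: "distr (sample_measure n \<theta>) borel (\<lambda>y. y t) = density lborel (normal_density \<theta> 1)"
    if "t \<in> {1..n}" for t
    using distr_PiM_component[of "{1..n}" ?N t, OF N that]
    unfolding sample_measure_def by (simp cong: distr_cong)
  have meas: "(\<lambda>y. y t) \<in> borel_measurable (sample_measure n \<theta>)" if "t \<in> {1..n}" for t
    unfolding sample_measure_def using that
    by (intro measurable_PiM_component_rev) auto
  have indep: "P.indep_vars (\<lambda>_. borel) (\<lambda>t y. y t) {1..n}"
  \<comment> \<open>Independence means that the joint law is the product of the marginals.
    Restriction to \<open>{1..n}\<close> is the identity on the product space, so the joint law is
    the sample measure itself.\<close>
  proof (subst P.indep_vars_iff_distr_eq_PiM')
    have "distr (sample_measure n \<theta>) (\<Pi>\<^sub>M i\<in>{1..n}. borel) (\<lambda>x. \<lambda>i\<in>{1..n}. x i)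
        = distr (sample_measure n \<theta>) (sample_measure n \<theta>) (\<lambda>x. x)"
      by (intro distr_cong)
         (auto simp: sample_measure_def space_PiM intro!: sets_PiM_cong)
    also have "\<dots> = (\<Pi>\<^sub>M i\<in>{1..n}. density lborel (normal_density \<theta> 1))"
      by (simp add: sample_measure_def)
    also have "\<dots> = (\<Pi>\<^sub>M i\<in>{1..n}. distr (sample_measure n \<theta>) borel (\<lambda>y. y i))"
      using comp by (intro PiM_cong) auto
    finally show "distr (sample_measure n \<theta>) (\<Pi>\<^sub>M i\<in>{1..n}. borel) (\<lambda>x. \<lambda>i\<in>{1..n}. x i)
        = (\<Pi>\<^sub>M i\<in>{1..n}. distr (sample_measure n \<theta>) borel (\<lambda>y. y i))" .
  qed (use n meas in auto)
  have "distributed (sample_measure n \<theta>) lborel (\<lambda>y. \<Sum>t\<in>{1..n}. y t)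
          (normal_density (\<Sum>t\<in>{1..n}. \<theta>) (sqrt (\<Sum>t\<in>{1..n}. 1\<^sup>2)))"
  proof (rule P.sum_indep_normal[OF _ _ indep])
    fix t assume t: "t \<in> {1..n}"
    show "distributed (sample_measure n \<theta>) lborel (\<lambda>y. y t) (normal_density \<theta> 1)"
      using comp[OF t] meas[OF t] by (auto simp: distributed_def cong: distr_cong)
  qed (use n in auto)
  then have "distributed (sample_measure n \<theta>) lborel
      (\<lambda>y. ((\<Sum>t\<in>{1..n}. y t) - real n * \<theta>) / sqrt (real n)) std_normal_density"
    using n by (subst (asm) P.normal_standard_normal_convert) auto
  also have "(\<lambda>y. ((\<Sum>t\<in>{1..n}. y t) - real n * \<theta>) / sqrt (real n))
      = (\<lambda>y. sqrt (real n) * (sample_mean n y - \<theta>))"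
  proof
    fix y
    have "((\<Sum>t\<in>{1..n}. y t) - real n * \<theta>) = real n * (sample_mean n y - \<theta>)"
      using n by (simp add: sample_mean_def field_simps)
    moreover have "real n / sqrt (real n) = sqrt (real n)"
      by (simp add: real_div_sqrt)
    ultimately show "((\<Sum>t\<in>{1..n}. y t) - real n * \<theta>) / sqrt (real n)
        = sqrt (real n) * (sample_mean n y - \<theta>)"
      by (metis times_divide_eq_left)
  qed
  finally show ?thesis .
qed

text \<open>Since \<open>s > 0\<close>, comparing \<open>m\<close> with \<open>h\<close> and
  \<open>- h\<close> is comparing \<open>s * (m - \<theta>)\<close> with
  \<open>- (s * \<theta>) + s * h\<close> and \<open>- (s * \<theta>) - s * h\<close>. In between
  the estimate is 0 and the error is \<open>- (s * \<theta>)\<close>.\<close>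

lemma soft_est_eq_soft_error:
  assumes "s > 0" and "h > 0"
  shows "s * (sgn m * max (\<bar>m\<bar> - h) 0 - \<theta>)
       = soft_error (s * h) (ereal (s * \<theta>)) (s * (m - \<theta>))"
proof -
  have 1: "s * (m - \<theta>) > - (s * \<theta>) + s * h \<longleftrightarrow> m > h"
    using assms by (simp add: right_diff_distrib)
  have "s * (m - \<theta>) < - (s * \<theta>) - s * h \<longleftrightarrow> s * m < s * (- h)"
    by (auto simp: right_diff_distrib)
  then have 2: "s * (m - \<theta>) < - (s * \<theta>) - s * h \<longleftrightarrow> m < - h"
    using assms mult_less_cancel_left_pos by blast
  have 3: "m > h \<Longrightarrow> sgn m * max (\<bar>m\<bar> - h) 0 = m - h"
    "m < - h \<Longrightarrow> sgn m * max (\<bar>m\<bar> - h) 0 = m + h"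
    "\<not> m > h \<Longrightarrow> \<not> m < - h \<Longrightarrow> sgn m * max (\<bar>m\<bar> - h) 0 = 0"
    using assms by (auto simp: sgn_if max_def)
  show ?thesis
    unfolding soft_error_def using 1 2 3 assms
    by (simp, auto simp: algebra_simps)
qed

lemma soft_dist_eq_soft_limit:
  assumes n: "n \<ge> 1" and h: "h > 0"
  shows "soft_dist h n \<theta> = soft_limit (sqrt (real n) * h) (ereal (sqrt (real n) * \<theta>))"
proof -
  let ?s = "sqrt (real n)"
  let ?Z = "\<lambda>y. ?s * (sample_mean n y - \<theta>)"
  have Z: "distr (sample_measure n \<theta>) lborel ?Z = std_normal"
    and [measurable]: "?Z \<in> borel_measurable (sample_measure n \<theta>)"
    using distributed_scaled_sample_mean[OF n] by (auto simp: distributed_def)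
  have "soft_dist h n \<theta>
      = distr (sample_measure n \<theta>) borel (soft_error (?s * h) (ereal (?s * \<theta>)) \<circ> ?Z)"
    unfolding soft_dist_def soft_est_def comp_def
    using n h by (simp add: soft_est_eq_soft_error)
  also have "\<dots> = distr (distr (sample_measure n \<theta>) lborel ?Z) borel
      (soft_error (?s * h) (ereal (?s * \<theta>)))"
    by (rule distr_distr[symmetric]) auto
  finally show ?thesis
    using h by (simp add: Z soft_limit_eq_distr)
qed

section \<open>The cases with a normal limit\<close>

lemma distr_std_normal_shift:
  "distr std_normal borel (\<lambda>z. c + z) = density lborel (normal_density c 1)"
proof -
  interpret real_distribution std_normal by (rule real_distribution_std_normal)
  have "distributed std_normal lborel (\<lambda>z. z) std_normal_density"
    by (simp add: distributed_def distr_id2)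
  from normal_density_affine[OF this, of 1 c]
  show ?thesis by (simp add: distributed_def cong: distr_cong)
qed

text \<open>\<open>soft_error\<close> is then a translation: for infinite \<open>\<nu>\<close> one
  outer branch is always taken, and for \<open>e = 0\<close> the middle branch is the single point
  \<open>z = - \<nu>\<close>, where it agrees with the identity.\<close>

lemma soft_limit_eq_normal:
  assumes "0 \<le> e" and "\<bar>\<nu>\<bar> = \<infinity> \<or> e = 0"
  shows "soft_limit e \<nu> = density lborel (normal_density (- real_of_ereal (sgn \<nu>) * e) 1)"
proof -
  have "soft_error e \<nu> = (\<lambda>z. - real_of_ereal (sgn \<nu>) * e + z)"
    using assms(2) by (cases \<nu>) (auto simp: soft_error_def fun_eq_iff)
  then show ?thesis
    unfolding soft_limit_eq_distr[OF assms(1)] by (simp only: distr_std_normal_shift)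
qed

section \<open>Continuity of the limit law in its parameters\<close>

lemma weak_conv_m_soft_limit:
  assumes nonneg: "\<forall>\<^sub>F n in sequentially. 0 \<le> b n" "0 \<le> e"
    and b: "b \<longlonglongrightarrow> e" and a: "a \<longlonglongrightarrow> \<nu>"
  shows "weak_conv_m (\<lambda>n. soft_limit (b n) (a n)) (soft_limit e \<nu>)"
  unfolding weak_conv_m_def weak_conv_def
proof (intro allI impI)
  fix x assume cont: "isCont (cdf (soft_limit e \<nu>)) x"
  let ?F = "cdf std_normal"
  have cdf: "\<forall>\<^sub>F n in sequentially.
      cdf (soft_limit (b n) (a n)) x = (if - a n \<le> ereal x then ?F (x + b n) else ?F (x - b n))"
    using nonneg(1) by eventually_elim (simp add: cdf_soft_limit)
  have plus: "(\<lambda>n. ?F (x + b n)) \<longlonglongrightarrow> ?F (x + e)"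
    and minus: "(\<lambda>n. ?F (x - b n)) \<longlonglongrightarrow> ?F (x - e)"
    by (intro isCont_tendsto_compose[OF isCont_cdf_std_normal] tendsto_intros b)+
  have ma: "(\<lambda>n. - a n) \<longlonglongrightarrow> - \<nu>"
    using a by (simp add: ereal_Lim_uminus[symmetric])
  \<comment> \<open>Away from \<open>- \<nu>\<close> the branch of the cdf is eventually that of the
    limit. At \<open>- \<nu>\<close> it may switch infinitely often, and only there is continuity of
    the limit cdf used.\<close>
  consider "- \<nu> < ereal x" | "ereal x < - \<nu>" | "- \<nu> = ereal x"
    by (meson linorder_neqE)
  then show "(\<lambda>n. cdf (soft_limit (b n) (a n)) x) \<longlonglongrightarrow> cdf (soft_limit e \<nu>) x"
  proof cases
    case 1
    then have "\<forall>\<^sub>F n in sequentially. - a n < ereal x"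
      using order_tendstoD(2)[OF ma] by blast
    then have "\<forall>\<^sub>F n in sequentially. ?F (x + b n) = cdf (soft_limit (b n) (a n)) x"
      using cdf by eventually_elim auto
    with plus 1 show ?thesis
      using nonneg(2) by (auto simp: cdf_soft_limit intro: Lim_transform_eventually)
  next
    case 2
    then have "\<forall>\<^sub>F n in sequentially. ereal x < - a n"
      using order_tendstoD(1)[OF ma] by blast
    then have "\<forall>\<^sub>F n in sequentially. ?F (x - b n) = cdf (soft_limit (b n) (a n)) x"
      using cdf by eventually_elim auto
    with minus 2 show ?thesis
      using nonneg(2) by (auto simp: cdf_soft_limit intro: Lim_transform_eventually)
  next
    case 3
    \<comment> \<open>The left limit at \<open>x\<close> is computed twice, from continuity and from
      the branch below \<open>- \<nu>\<close>; equality says that the atom at \<open>x\<close> has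
      no mass.\<close>
    have "(cdf (soft_limit e \<nu>) \<longlongrightarrow> ?F (x + e)) (at_left x)"
      using cont 3 nonneg(2)
      by (auto simp: isCont_def cdf_soft_limit intro: filterlim_mono at_le)
    moreover have "(cdf (soft_limit e \<nu>) \<longlongrightarrow> ?F (x - e)) (at_left x)"
    proof (rule Lim_transform_eventually)
      show "((\<lambda>t. ?F (t - e)) \<longlongrightarrow> ?F (x - e)) (at_left x)"
        by (intro isCont_tendsto_compose[OF isCont_cdf_std_normal] tendsto_intros)
      show "\<forall>\<^sub>F t in at_left x. ?F (t - e) = cdf (soft_limit e \<nu>) t"
        using 3 nonneg(2)
        by (auto simp: cdf_soft_limit eventually_at_filter)
    qed
    ultimately have eq: "?F (x + e) = ?F (x - e)"
      using tendsto_unique trivial_limit_at_left_real by blast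
    \<comment> \<open>By \<open>eq\<close> both branches have the same limit, so switching between
      them is harmless.\<close>
    have "(\<lambda>n. if - a n \<le> ereal x then ?F (x + b n) else ?F (x - b n)) \<longlonglongrightarrow> ?F (x + e)"
      using plus minus[folded eq] by (intro filterlim_If) (auto intro: tendsto_mono[OF inf_le1])
    moreover have "cdf (soft_limit e \<nu>) x = ?F (x + e)"
      using 3 nonneg(2) by (simp add: cdf_soft_limit)
    ultimately show ?thesis
      using cdf by (simp add: tendsto_cong)
  qed
qed

theorem theorem5:
  fixes \<eta> \<theta> :: "nat \<Rightarrow> real" and e :: real and \<nu> :: ereal
  assumes "\<And>n. n \<ge> 1 \<Longrightarrow> \<eta> n > 0"
    and "\<eta> \<longlonglongrightarrow> 0"
    and "(\<lambda>n. sqrt (real n) * \<eta> n) \<longlonglongrightarrow> e"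
    and "0 \<le> e"
    and "(\<lambda>n. ereal (sqrt (real n) * \<theta> n)) \<longlonglongrightarrow> \<nu>"
  shows "real_distribution (soft_limit e \<nu>)
    \<and> weak_conv_m (\<lambda>n. soft_dist (\<eta> n) n (\<theta> n)) (soft_limit e \<nu>)
    \<and> (\<bar>\<nu>\<bar> = \<infinity> \<or> e = 0 \<longrightarrow>
         soft_limit e \<nu> = density lborel (normal_density (- real_of_ereal (sgn \<nu>) * e) 1))"
proof (intro conjI impI)
  show "real_distribution (soft_limit e \<nu>)"
    using assms(4) by (rule real_distribution_soft_limit)
  let ?L = "\<lambda>n. soft_limit (sqrt (real n) * \<eta> n) (ereal (sqrt (real n) * \<theta> n))"
  have "\<forall>\<^sub>F n in sequentially. 0 \<le> sqrt (real n) * \<eta> n"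
    using eventually_ge_at_top[of 1] by eventually_elim (simp add: assms(1) less_imp_le)
  then have L: "weak_conv_m ?L (soft_limit e \<nu>)"
    using assms by (intro weak_conv_m_soft_limit)
  \<comment> \<open>The exact law is available from \<open>n = 1\<close> on; the term at
    \<open>n = 0\<close> does not affect the limit.\<close>
  have "\<forall>\<^sub>F n in sequentially. ?L n = soft_dist (\<eta> n) n (\<theta> n)"
    using eventually_ge_at_top[of 1]
    by eventually_elim (simp add: assms(1) soft_dist_eq_soft_limit)
  then have "\<forall>\<^sub>F n in sequentially. cdf (?L n) x = cdf (soft_dist (\<eta> n) n (\<theta> n)) x" for x
    by eventually_elim simp
  with L show "weak_conv_m (\<lambda>n. soft_dist (\<eta> n) n (\<theta> n)) (soft_limit e \<nu>)"
    unfolding weak_conv_m_def weak_conv_def by (blast intro: Lim_transform_eventually)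
  show "soft_limit e \<nu> = density lborel (normal_density (- real_of_ereal (sgn \<nu>) * e) 1)"
    if "\<bar>\<nu>\<bar> = \<infinity> \<or> e = 0"
    using assms(4) that by (rule soft_limit_eq_normal)
qed

end
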